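(* Let $X$ be a real normed space, let $\mathcal F$ be a directionally fine family of closed cones in $X$, and let $L,K\subset X$ be cones such that $L\cap K=\{0_X\}$, with $K$ closed and $L$ locally compact. Set $d:=d(B_L,K)$. Then $d>0$, and for every $0<\varepsilon<\min\{1,d\}$ there exists a closed cone $D_L^\varepsilon$, which is a finite union of members of $\mathcal F$, such that \[ L\setminus\{0_X\}\subset\operatorname{int}D_L^\varepsilon,\qquad L\subset D_L^\varepsilon\subset L_\varepsilon,\qquad D_L^\varepsilon\cap K=\{0_X\}. \]
   Context: $S_X$, $B_X$ are the unit sphere and closed unit ball, $B(x,r)=x+rB_X$, $\operatorname{cone}(A)=\{ta:t\ge0,\ a\in A\}$, $d(A,B)=\inf_{a\in A,\,b\in B}\|a-b\|$. A nonempty set $C\subset X$ is a cone if $tC\subset C$ for every $t\ge 0$; all cones are assumed proper, i.e. $\{0_X\}\subsetneq C\subsetneq X$ (not necessarily convex). A family $\mathcal F$ of closed cones in $X$ is directionally fine if for every $u\in S_X$ and $\varepsilon\in(0,1)$ there exists $C\in\mathcal F$ with $u\in\operatorname{int}C\subset C\subset\operatorname{cone}B(u,\varepsilon)$. A cone $L$ is locally compact if for every $x\in L$ there is $r>0$ with $L\cap B(x,r)$ norm compact. $B_L:=L\cap S_X$ is the norm-base of $L$, and $L_\varepsilon:=\operatorname{cone}(B_L+\varepsilon B_X)$. *)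

theory Defs
  imports "HOL-Analysis.Analysis"
begin

definition proper_cone :: "'a::real_normed_vector set \<Rightarrow> bool" where
  "proper_cone C \<longleftrightarrow> cone C \<and> {0} \<subset> C \<and> C \<subset> UNIV"

definition cone_gen :: "'a::real_normed_vector set \<Rightarrow> 'a set" where
  "cone_gen A = {t *\<^sub>R a | t a. 0 \<le> t \<and> a \<in> A}"

definition directionally_fine :: "'a::real_normed_vector set set \<Rightarrow> bool" where
  "directionally_fine \<F> \<longleftrightarrow>
     (\<forall>C\<in>\<F>. proper_cone C \<and> closed C) \<and>
     (\<forall>u\<in>sphere 0 1. \<forall>\<epsilon>::real. 0 < \<epsilon> \<and> \<epsilon> < 1 \<longrightarrow>
        (\<exists>C\<in>\<F>. u \<in> interior C \<and> C \<subseteq> cone_gen (cball u \<epsilon>)))"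

definition locally_compact_cone :: "'a::real_normed_vector set \<Rightarrow> bool" where
  "locally_compact_cone L \<longleftrightarrow>
     proper_cone L \<and> (\<forall>x\<in>L. \<exists>r>0. compact (L \<inter> cball x r))"

definition norm_base :: "'a::real_normed_vector set \<Rightarrow> 'a set" where
  "norm_base L = L \<inter> sphere 0 1"

definition cone_enlargement :: "'a::real_normed_vector set \<Rightarrow> real \<Rightarrow> 'a set" where
  "cone_enlargement L \<epsilon> = cone_gen {b + \<epsilon> *\<^sub>R v | b v. b \<in> norm_base L \<and> v \<in> cball 0 1}"

end

theory Submission
  imports Defs
begin

text \<open>
  Local compactness of \<open>L\<close> at the origin, rescaled, makes the norm base of \<open>L\<close> compact; being
  disjoint from the closed cone \<open>K\<close>, it has positive distance \<open>d\<close> from \<open>K\<close>. The interiors of the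
  members of the family contained in the enlargement of \<open>L\<close> by \<open>\<epsilon>\<close> cover the norm base, and the
  union of a finite subcover is the required cone. A nonzero point of \<open>K\<close> in the enlargement could be
  rescaled to a point of \<open>K\<close> at distance at most \<open>\<epsilon> < d\<close> from the norm base.
\<close>

lemma compact_norm_base:
  fixes L :: "'a::real_normed_vector set"
  assumes "locally_compact_cone L"
  shows "compact (norm_base L)"
proof -
  have cone: "cone L" and "0 \<in> L"
    using assms by (auto simp: locally_compact_cone_def proper_cone_def)
  then obtain r where r: "r > 0" "compact (L \<inter> cball 0 r)"
    using assms by (auto simp: locally_compact_cone_def)
  \<comment> \<open>The radius \<open>r\<close> given at the origin need not reach 1, so compactness
    is shown on the sphere of radius \<open>r\<close> and carried to the unit sphere by the dilation
    with factor \<open>1 / r\<close>.\<close>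
  have "closed (sphere (0::'a) r)"
    unfolding sphere_def by (intro closed_Collect_eq continuous_intros)
  then have "compact (L \<inter> cball 0 r \<inter> sphere 0 r)"
    by (rule compact_Int_closed[OF r(2)])
  then have "compact ((*\<^sub>R) (1 / r) ` (L \<inter> cball 0 r \<inter> sphere 0 r))"
    by (rule compact_scaling)
  moreover have "(*\<^sub>R) (1 / r) ` (L \<inter> cball 0 r \<inter> sphere 0 r) = norm_base L"
  proof (intro equalityI subsetI)
    fix x assume "x \<in> norm_base L"
    then have "x = (1 / r) *\<^sub>R (r *\<^sub>R x)" "r *\<^sub>R x \<in> L \<inter> cball 0 r \<inter> sphere 0 r"
      using r cone by (auto simp: norm_base_def cone_def)
    then show "x \<in> (*\<^sub>R) (1 / r) ` (L \<inter> cball 0 r \<inter> sphere 0 r)"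
      by (rule image_eqI)
  next
    fix x assume "x \<in> (*\<^sub>R) (1 / r) ` (L \<inter> cball 0 r \<inter> sphere 0 r)"
    then obtain y where "x = (1 / r) *\<^sub>R y" "y \<in> L \<inter> cball 0 r \<inter> sphere 0 r"
      by blast
    then show "x \<in> norm_base L"
      using r cone by (auto simp: norm_base_def cone_def)
  qed
  ultimately show ?thesis
    by simp
qed

lemma normalize_in_norm_base:
  assumes "cone L" "x \<in> L" "x \<noteq> 0"
  shows "(1 / norm x) *\<^sub>R x \<in> norm_base L"
  using assms by (auto simp: norm_base_def cone_def)

lemma norm_base_nonempty:
  assumes "proper_cone L"
  shows "norm_base L \<noteq> {}"
proof -
  obtain x where "x \<in> L" "x \<noteq> 0"
    using assms by (auto simp: proper_cone_def)
  then show ?thesis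
    using normalize_in_norm_base assms unfolding proper_cone_def by blast
qed

text \<open>A dilation with positive factor is an open map sending the cone into itself. This
  extends coverage by interiors from the norm base to all of \<open>L - {0}\<close>. The factor 0
  has to be excluded: a cone with 0 in its interior is the whole space.\<close>

lemma cone_scaleR_in_interior:
  fixes C :: "'a::real_normed_vector set"
  assumes "cone C" "x \<in> interior C" "0 < t"
  shows "t *\<^sub>R x \<in> interior C"
proof -
  have "(*\<^sub>R) t ` interior C \<subseteq> C"
    using assms interior_subset by (fastforce simp: cone_def)
  moreover have "open ((*\<^sub>R) t ` interior C)"
    using assms by (intro open_scaling) auto
  ultimately show ?thesis
    using assms interior_maximal by blast
qed

lemma cone_gen_cball_subset_enlargement:
  assumes "u \<in> norm_base L" "0 < \<epsilon>"
  shows "cone_gen (cball u \<epsilon>) \<subseteq> cone_enlargement L \<epsilon>"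
proof -
  have "cball u \<epsilon> \<subseteq> {b + \<epsilon> *\<^sub>R v | b v. b \<in> norm_base L \<and> v \<in> cball 0 1}"
  proof
    fix y assume "y \<in> cball u \<epsilon>"
    then have "y = u + \<epsilon> *\<^sub>R ((1 / \<epsilon>) *\<^sub>R (y - u))" "(1 / \<epsilon>) *\<^sub>R (y - u) \<in> cball 0 1"
      using assms by (auto simp: dist_norm norm_minus_commute)
    then show "y \<in> {b + \<epsilon> *\<^sub>R v | b v. b \<in> norm_base L \<and> v \<in> cball 0 1}"
      using assms by blast
  qed
  then show ?thesis
    unfolding cone_enlargement_def cone_gen_def by blast
qed

lemma cone_enlargement_Int_cone:
  assumes "cone K" "0 < \<epsilon>" "\<epsilon> < setdist (norm_base L) K"
  shows "cone_enlargement L \<epsilon> \<inter> K \<subseteq> {0}"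
proof
  fix x assume x: "x \<in> cone_enlargement L \<epsilon> \<inter> K"
  then obtain t b v where t: "x = t *\<^sub>R (b + \<epsilon> *\<^sub>R v)" "0 \<le> t" "b \<in> norm_base L" "norm v \<le> 1"
    by (auto simp: cone_enlargement_def cone_gen_def)
  show "x \<in> {0}"
  proof (rule ccontr)
    assume "x \<notin> {0}"
    \<comment> \<open>Since \<open>t = 0\<close> would give \<open>x = 0\<close>, the factor
      \<open>t\<close> can be divided out without leaving \<open>K\<close>.\<close>
    then have "t > 0"
      using t by (cases "t = 0") auto
    then have "b + \<epsilon> *\<^sub>R v = (1 / t) *\<^sub>R x"
      using t by simp
    also have "\<dots> \<in> K"
      using x \<open>t > 0\<close> assms(1) by (auto simp: cone_def)
    finally have "setdist (norm_base L) K \<le> dist b (b + \<epsilon> *\<^sub>R v)"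
      using t by (intro setdist_le_dist)
    also have "\<dots> \<le> \<epsilon>"
      using t assms by (simp add: dist_norm mult_left_le)
    finally show False
      using assms by simp
  qed
qed

lemma setdist_norm_base_pos:
  assumes "locally_compact_cone L" "proper_cone K" "closed K" "L \<inter> K = {0}"
  shows "setdist (norm_base L) K > 0"
proof -
  \<comment> \<open>\<open>setdist\<close> is 0 by convention when one of the sets is empty, so
    positivity needs both to be nonempty.\<close>
  have "norm_base L \<noteq> {}" "K \<noteq> {}"
    using assms norm_base_nonempty
    by (auto simp: locally_compact_cone_def proper_cone_def)
  moreover have "norm_base L \<inter> K \<subseteq> L \<inter> K \<inter> sphere 0 1"
    by (auto simp: norm_base_def)
  then have "norm_base L \<inter> K = {}"
    using assms(4) by auto
  ultimately show ?thesis
    using setdist_gt_0_compact_closed[OF compact_norm_base] assms by blast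
qed

lemma finite_fine_cover_norm_base:
  assumes "directionally_fine \<F>" "locally_compact_cone L" "0 < \<epsilon>" "\<epsilon> < 1"
  obtains \<G> where "finite \<G>" "\<G> \<subseteq> \<F>" "norm_base L \<subseteq> (\<Union>C\<in>\<G>. interior C)"
    "\<Union>\<G> \<subseteq> cone_enlargement L \<epsilon>"
proof -
  \<comment> \<open>Restricting the family before extracting a subcover makes every chosen member
    lie in the enlargement automatically.\<close>
  define \<H> where "\<H> = {C \<in> \<F>. C \<subseteq> cone_enlargement L \<epsilon>}"
  have cover: "norm_base L \<subseteq> (\<Union>C\<in>\<H>. interior C)"
  proof
    fix u assume u: "u \<in> norm_base L"
    then obtain C where "C \<in> \<F>" "u \<in> interior C" "C \<subseteq> cone_gen (cball u \<epsilon>)"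
      using assms unfolding directionally_fine_def norm_base_def by blast
    then show "u \<in> (\<Union>C\<in>\<H>. interior C)"
      using cone_gen_cball_subset_enlargement[OF u \<open>0 < \<epsilon>\<close>] by (auto simp: \<H>_def)
  qed
  obtain \<G> where "\<G> \<subseteq> \<H>" "finite \<G>" "norm_base L \<subseteq> (\<Union>C\<in>\<G>. interior C)"
    by (rule compactE_image[OF compact_norm_base[OF assms(2)] _ cover]) auto
  then show ?thesis
    using that[of \<G>] unfolding \<H>_def by blast
qed

theorem theorem3p23:
  fixes \<F> :: "'a::real_normed_vector set set" and L K :: "'a set"
  assumes "directionally_fine \<F>"
    and "proper_cone L" and "proper_cone K"
    and "L \<inter> K = {0}"
    and "closed K"
    and "locally_compact_cone L"
  shows "setdist (norm_base L) K > 0 \<and>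
    (\<forall>\<epsilon>::real. 0 < \<epsilon> \<and> \<epsilon> < min 1 (setdist (norm_base L) K) \<longrightarrow>
      (\<exists>D. proper_cone D \<and> closed D \<and>
           (\<exists>\<G>. finite \<G> \<and> \<G> \<subseteq> \<F> \<and> D = \<Union>\<G>) \<and>
           L - {0} \<subseteq> interior D \<and>
           L \<subseteq> D \<and> D \<subseteq> cone_enlargement L \<epsilon> \<and>
           D \<inter> K = {0}))"
proof (intro conjI allI impI)
  show "setdist (norm_base L) K > 0"
    using assms by (intro setdist_norm_base_pos)
next
  fix \<epsilon> :: real
  assume \<epsilon>: "0 < \<epsilon> \<and> \<epsilon> < min 1 (setdist (norm_base L) K)"
  obtain \<G> where \<G>: "finite \<G>" "\<G> \<subseteq> \<F>" "norm_base L \<subseteq> (\<Union>C\<in>\<G>. interior C)"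
    "\<Union>\<G> \<subseteq> cone_enlargement L \<epsilon>"
    using finite_fine_cover_norm_base[OF assms(1,6)] \<epsilon> by auto
  have members: "cone C" "0 \<in> C" "closed C" if "C \<in> \<G>" for C
    using that \<G>(2) assms(1) by (auto simp: directionally_fine_def proper_cone_def)
  have cone_L: "cone L" and cone_K: "cone K"
    using assms by (auto simp: proper_cone_def)
  have int: "L - {0} \<subseteq> interior (\<Union>\<G>)"
  proof
    fix x assume x: "x \<in> L - {0}"
    then obtain C where C: "C \<in> \<G>" "(1 / norm x) *\<^sub>R x \<in> interior C"
      using normalize_in_norm_base[OF cone_L, of x] \<G>(3) by blast
    then have "norm x *\<^sub>R ((1 / norm x) *\<^sub>R x) \<in> interior C"
      using x cone_scaleR_in_interior[OF members(1)] by (metis DiffE insertI1 zero_less_norm_iff)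
    then have "x \<in> interior C"
      using x by simp
    then show "x \<in> interior (\<Union>\<G>)"
      using C interior_mono[of C "\<Union>\<G>"] by blast
  qed
  \<comment> \<open>The origin is not reached by \<open>int\<close>. A nonempty norm base forces
    \<open>\<G>\<close> to have a member, and every member contains 0.\<close>
  have zero: "0 \<in> \<Union>\<G>"
    using norm_base_nonempty[OF assms(2)] \<G>(3) members by blast
  have sub: "L \<subseteq> \<Union>\<G>"
    using int zero interior_subset by blast
  have disj: "\<Union>\<G> \<inter> K = {0}"
    using cone_enlargement_Int_cone[OF cone_K, of \<epsilon> L] \<epsilon> \<G>(4) zero assms(3)
    by (auto simp: proper_cone_def)
  have "cone (\<Union>\<G>)"
    using members unfolding cone_def by blast
  moreover have "{0} \<subset> \<Union>\<G>"
    using sub assms(2) by (auto simp: proper_cone_def)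
  \<comment> \<open>\<open>K\<close> has a nonzero point, which \<open>disj\<close> keeps out of the
    union.\<close>
  moreover have "\<Union>\<G> \<subset> UNIV"
    using disj assms(3) by (auto simp: proper_cone_def)
  ultimately have "proper_cone (\<Union>\<G>)"
    by (simp add: proper_cone_def)
  \<comment> \<open>This is where finiteness of the subcover, hence compactness of the norm base,
    enters.\<close>
  moreover have "closed (\<Union>\<G>)"
    using \<G>(1) members by (intro closed_Union) auto
  ultimately show "\<exists>D. proper_cone D \<and> closed D \<and>
           (\<exists>\<G>. finite \<G> \<and> \<G> \<subseteq> \<F> \<and> D = \<Union>\<G>) \<and>
           L - {0} \<subseteq> interior D \<and>
           L \<subseteq> D \<and> D \<subseteq> cone_enlargement L \<epsilon> \<and>
           D \<inter> K = {0}"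
    using \<G> int sub disj by blast
qed

end
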